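(* For any triangle-free graph $G$ with $\alpha(G)\geq\frac25$, we have $\beta(G)\leq\frac1{50}$.
   Context: All graphs are finite and simple. For a graph $G$ with $n\geq 1$ vertices, $\alpha(G)=\max\{|A|/n : A\subseteq V(G) \text{ an independent set}\}$ is the relative independence number. A half in $G$ is a function $\mu: V(G)\to[0,1]$ such that $\sum_{v\in V(G)}\mu(v)=n/2$. Put $\beta(G,\mu)=\frac1{n^2}\sum_{\{u,v\}\in E(G)}\mu(u)\mu(v)$ (each edge is counted once) and $\beta(G)=\min\{\beta(G,\mu): \mu \text{ is a half in } G\}$. *)

theory Defs
  imports "HOL-Analysis.Analysis"
begin

text \<open>A finite simple graph is given by a vertex set \<open>V\<close> and a set \<open>E\<close> of edges, each edge being the
  unordered pair of its two distinct end points.\<close>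

definition simple_graph :: "'a set \<Rightarrow> 'a set set \<Rightarrow> bool" where
  "simple_graph V E \<longleftrightarrow> finite V \<and> (\<forall>e\<in>E. e \<subseteq> V \<and> card e = 2)"

definition triangle_free :: "'a set set \<Rightarrow> bool" where
  "triangle_free E \<longleftrightarrow>
     \<not> (\<exists>u v w. distinct [u, v, w] \<and> {u, v} \<in> E \<and> {v, w} \<in> E \<and> {u, w} \<in> E)"

definition independent_set :: "'a set \<Rightarrow> 'a set set \<Rightarrow> 'a set \<Rightarrow> bool" where
  "independent_set V E A \<longleftrightarrow> A \<subseteq> V \<and> (\<forall>u\<in>A. \<forall>v\<in>A. {u, v} \<notin> E)"

definition rel_indep_number :: "'a set \<Rightarrow> 'a set set \<Rightarrow> real" where
  "rel_indep_number V E = Max {real (card A) / real (card V) |A. independent_set V E A}"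

text \<open>The values of \<open>\<mu>\<close> outside \<open>V\<close> are irrelevant and left unconstrained.\<close>

definition is_half :: "'a set \<Rightarrow> ('a \<Rightarrow> real) \<Rightarrow> bool" where
  "is_half V \<mu> \<longleftrightarrow> (\<forall>v\<in>V. \<mu> v \<in> {0..1}) \<and> (\<Sum>v\<in>V. \<mu> v) = real (card V) / 2"

text \<open>For an edge \<open>e = {u, v}\<close> the product over \<open>e\<close> is \<open>\<mu> u * \<mu> v\<close>, so every edge counts once.\<close>

definition half_density :: "'a set \<Rightarrow> 'a set set \<Rightarrow> ('a \<Rightarrow> real) \<Rightarrow> real" where
  "half_density V E \<mu> = (\<Sum>e\<in>E. \<Prod>v\<in>e. \<mu> v) / (real (card V))\<^sup>2"

text \<open>The minimum over all halves is written as an infimum; it is attained, see below.\<close>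

definition min_half_density :: "'a set \<Rightarrow> 'a set set \<Rightarrow> real" where
  "min_half_density V E = (INF \<mu>\<in>{\<mu>. is_half V \<mu>}. half_density V E \<mu>)"

lemma min_half_density_attained:
  fixes V :: "'a set"
  assumes G: "simple_graph V E"
  shows "\<exists>\<mu>. is_half V \<mu> \<and> half_density V E \<mu> = min_half_density V E
            \<and> (\<forall>\<nu>. is_half V \<nu> \<longrightarrow> half_density V E \<mu> \<le> half_density V E \<nu>)"
proof -
  define B :: "'a \<Rightarrow> real set" where "B v = (if v \<in> V then {0..1} else {0})" for v
  define K where "K = PiE UNIV B \<inter> {\<mu>. (\<Sum>v\<in>V. \<mu> v) = real (card V) / 2}"
  have coord: "continuous_on S (\<lambda>\<mu>::'a \<Rightarrow> real. \<mu> v)" for S v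
    by (rule continuous_on_subset[OF continuous_on_product_coordinates]) simp
  have cB: "compact (B v)" for v by (simp add: B_def)
  have "compact (PiE UNIV B)"
    using cB compactin_PiE[of "\<lambda>_. euclidean" UNIV B]
    by (simp add: euclidean_product_topology flip: compactin_euclidean_iff)
  moreover have "closed {\<mu>::'a \<Rightarrow> real. (\<Sum>v\<in>V. \<mu> v) = real (card V) / 2}"
    by (intro closed_Collect_eq continuous_on_sum coord continuous_on_const)
  ultimately have cK: "compact K"
    unfolding K_def by (rule compact_Int_closed)
  have half_K: "is_half V \<mu>" if "\<mu> \<in> K" for \<mu>
    using that by (auto simp: K_def B_def is_half_def PiE_iff split: if_splits)
  have "(\<lambda>v. if v \<in> V then 1/2 else 0) \<in> K"
    by (auto simp: K_def B_def PiE_iff)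
  then have neK: "K \<noteq> {}" by blast
  have contK: "continuous_on K (half_density V E)"
    unfolding half_density_def divide_inverse
    by (intro continuous_on_mult continuous_on_sum continuous_on_prod coord continuous_on_const)
  obtain \<mu> where \<mu>: "\<mu> \<in> K" and min: "\<And>\<nu>. \<nu> \<in> K \<Longrightarrow> half_density V E \<mu> \<le> half_density V E \<nu>"
    using continuous_attains_inf[OF cK neK contK] by blast
  have le: "half_density V E \<mu> \<le> half_density V E \<nu>" if \<nu>: "is_half V \<nu>" for \<nu>
  proof -
    define \<nu>' where "\<nu>' v = (if v \<in> V then \<nu> v else 0)" for v
    have "\<nu>' \<in> K"
      using \<nu> by (auto simp: \<nu>'_def K_def B_def is_half_def PiE_iff)
    moreover have "half_density V E \<nu>' = half_density V E \<nu>"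
    proof -
      have "(\<Prod>v\<in>e. \<nu>' v) = (\<Prod>v\<in>e. \<nu> v)" if "e \<in> E" for e
        using that G by (intro prod.cong) (auto simp: \<nu>'_def simple_graph_def)
      then show ?thesis by (simp add: half_density_def)
    qed
    ultimately show ?thesis using min by fastforce
  qed
  have "min_half_density V E = half_density V E \<mu>"
    unfolding min_half_density_def
    by (rule cInf_eq_minimum) (use half_K[OF \<mu>] le in auto)
  then show ?thesis using half_K[OF \<mu>] le by metis
qed

end

theory Submission
  imports Defs
begin

text \<open>Let \<open>A\<close> be a maximum independent set, \<open>K = |A| < n/2\<close>, \<open>s = n/2 - K\<close>, and let \<open>a v\<close> be the number of
  neighbours of \<open>v\<close> in \<open>A\<close>. Since \<open>a u + a v \<le> K\<close> on edges, the vertices outside \<open>A\<close> with \<open>a v > K/2\<close> are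
  independent, so at most \<open>K\<close> many, and the set \<open>L\<close> of the other ones has at least \<open>2s\<close> elements. It suffices
  to extend \<open>A\<close> by mass \<open>s\<close> on \<open>L\<close> at cost at most \<open>sK/2\<close>, which is at most \<open>n\<^sup>2/50\<close> for \<open>K \<ge> 2n/5\<close>.
  An independent subset of \<open>L\<close> of size at least \<open>s\<close> does this at once; otherwise all degrees within \<open>L\<close> are
  at most \<open>s\<close>. Then, for \<open>w \<in> A\<close>, take the neighbourhood \<open>I w\<close> of \<open>w\<close> in \<open>L\<close>, next the vertices
  with \<open>a v < K/4\<close>, and spread the remaining mass evenly over \<open>L\<close>. As each \<open>v\<close> lies in exactly \<open>a v\<close>
  of the sets \<open>I w\<close>, averaging over \<open>w\<close> shows that some \<open>w\<close> achieves the required cost.\<close>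

section \<open>Adjacency indicators and sums over edges\<close>

definition adj :: "'a set set \<Rightarrow> 'a \<Rightarrow> 'a \<Rightarrow> real" where
  "adj E u v = of_bool ({u, v} \<in> E)"

definition deg_in :: "'a set set \<Rightarrow> 'a set \<Rightarrow> 'a \<Rightarrow> real" where
  "deg_in E S v = (\<Sum>u\<in>S. adj E u v)"

lemma adj_commute: "adj E u v = adj E v u"
  by (simp add: adj_def insert_commute)

lemma adj_nonneg: "0 \<le> adj E u v"
  by (simp add: adj_def)

lemma adj_independent:
  "independent_set V E I \<Longrightarrow> u \<in> I \<Longrightarrow> v \<in> I \<Longrightarrow> adj E u v = 0"
  by (auto simp: adj_def independent_set_def)

lemma deg_in_eq_card: "finite S \<Longrightarrow> deg_in E S v = real (card {u \<in> S. {u, v} \<in> E})"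
  by (simp add: deg_in_def adj_def of_bool_def Int_def flip: sum.inter_filter)

text \<open>Double counting: after exchanging the sums, \<open>v\<close> is counted once for each of
  its neighbours in \<open>A\<close>. This drives the averaging over \<open>A\<close>.\<close>

lemma sum_deg_in:
  "(\<Sum>w\<in>A. \<Sum>v | v \<in> S \<and> {w, v} \<in> E. f v) = (\<Sum>v\<in>S. deg_in E A v * f v)"
  if "finite S"
proof -
  have "(\<Sum>v | v \<in> S \<and> {w, v} \<in> E. f v) = (\<Sum>v\<in>S. adj E w v * f v)" for w
    unfolding sum.inter_filter[OF that] by (intro sum.cong) (auto simp: adj_def)
  then have "(\<Sum>w\<in>A. \<Sum>v | v \<in> S \<and> {w, v} \<in> E. f v) = (\<Sum>w\<in>A. \<Sum>v\<in>S. adj E w v * f v)"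
    by simp
  also have "\<dots> = (\<Sum>v\<in>S. deg_in E A v * f v)"
    by (subst sum.swap) (simp add: deg_in_def sum_distrib_right)
  finally show ?thesis .
qed

text \<open>Each edge arises from exactly two ordered pairs of vertices. This turns sums over
  unordered edges into double sums that can be split and exchanged.\<close>

lemma sum_edges_eq_sum_pairs:
  fixes \<mu> :: "'a \<Rightarrow> real"
  assumes G: "simple_graph V E"
  shows "2 * (\<Sum>e\<in>E. \<Prod>v\<in>e. \<mu> v) = (\<Sum>u\<in>V. \<Sum>v\<in>V. adj E u v * (\<mu> u * \<mu> v))"
proof -
  define P where "P = {p \<in> V \<times> V. {fst p, snd p} \<in> E}"
  have fV: "finite V" and sub: "\<And>e. e \<in> E \<Longrightarrow> e \<subseteq> V \<and> card e = 2"
    using G by (auto simp: simple_graph_def)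
  have fE: "finite E"
    by (rule finite_subset[of _ "Pow V"]) (use sub fV in auto)
  have fP: "finite P"
    using fV by (simp add: P_def)
  have fibre: "(\<Sum>p | p \<in> P \<and> {fst p, snd p} = e. \<mu> (fst p) * \<mu> (snd p)) = 2 * (\<Prod>v\<in>e. \<mu> v)"
    if e: "e \<in> E" for e
  proof -
    obtain x y where xy: "e = {x, y}" "x \<noteq> y"
      using sub[OF e] by (auto simp: card_2_iff)
    have "{p \<in> P. {fst p, snd p} = e} = {(x, y), (y, x)}"
    proof (rule set_eqI)
      fix p
      have "x \<in> V" "y \<in> V" using sub[OF e] xy by auto
      moreover have "{x, y} \<in> E" "{y, x} \<in> E" using e xy by (simp_all add: insert_commute)
      ultimately show "p \<in> {p \<in> P. {fst p, snd p} = e} \<longleftrightarrow> p \<in> {(x, y), (y, x)}"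
        unfolding P_def xy(1) by (cases p) (simp add: doubleton_eq_iff, blast)
    qed
    with xy show ?thesis by simp
  qed
  have "(\<Sum>u\<in>V. \<Sum>v\<in>V. adj E u v * (\<mu> u * \<mu> v))
      = (\<Sum>p\<in>V \<times> V. adj E (fst p) (snd p) * (\<mu> (fst p) * \<mu> (snd p)))"
    by (simp add: sum.cartesian_product case_prod_unfold)
  also have "\<dots> = (\<Sum>p\<in>P. \<mu> (fst p) * \<mu> (snd p))"
    unfolding P_def sum.inter_filter[OF finite_cartesian_product[OF fV fV]]
    by (intro sum.cong) (auto simp: adj_def)
  also have "\<dots> = (\<Sum>e\<in>E. \<Sum>p | p \<in> P \<and> {fst p, snd p} = e. \<mu> (fst p) * \<mu> (snd p))"
    by (rule sum.group[OF fP fE, symmetric]) (auto simp: P_def)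
  also have "\<dots> = 2 * (\<Sum>e\<in>E. \<Prod>v\<in>e. \<mu> v)"
    by (simp add: fibre sum_distrib_left)
  finally show ?thesis by simp
qed

text \<open>Edges have two distinct ends, so the distinctness demanded by
  \<open>triangle_free\<close> comes for free.\<close>

lemma no_triangle:
  assumes G: "simple_graph V E" and tf: "triangle_free E"
    and "{u, v} \<in> E" "{w, u} \<in> E" "{w, v} \<in> E"
  shows False
proof -
  have "x \<noteq> y" if "{x, y} \<in> E" for x y
  proof -
    have "card {x, y} = 2" using G that unfolding simple_graph_def by blast
    then show ?thesis by auto
  qed
  then have "distinct [w, u, v]" using assms(3-5) by simp
  with tf assms(3-5) show False unfolding triangle_free_def by blast
qed

section \<open>Halves extending an independent set\<close>

lemma min_half_density_le:
  assumes "simple_graph V E" "is_half V \<mu>"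
  shows "min_half_density V E \<le> half_density V E \<mu>"
  using min_half_density_attained[OF assms(1)] assms(2) by metis

text \<open>An edge with weight in the sum has an end outside \<open>I\<close>. As all weights are
  at most 1, its product is at most the total of \<open>\<rho>\<close> over its ends outside
  \<open>I\<close>; summing, each such vertex is charged at most \<open>s\<close> times. The factor
  2 reflects ordered pairs.\<close>

lemma sum_pairs_extend_le:
  fixes \<rho> :: "'a \<Rightarrow> real"
  assumes L: "finite L" and I: "independent_set V E I" "I \<subseteq> L"
    and deg: "\<And>v. v \<in> L \<Longrightarrow> deg_in E L v \<le> s"
    and \<rho>: "\<And>v. v \<in> L - I \<Longrightarrow> 0 \<le> \<rho> v \<and> \<rho> v \<le> 1"
  defines "\<nu> v \<equiv> if v \<in> I then 1 else \<rho> v"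
  shows "(\<Sum>u\<in>L. \<Sum>v\<in>L. adj E u v * (\<nu> u * \<nu> v)) \<le> 2 * s * (\<Sum>v\<in>L - I. \<rho> v)"
proof -
  define \<sigma> where "\<sigma> v = (if v \<in> I then 0 else \<rho> v)" for v
  have \<nu>: "\<nu> v \<le> 1" and \<sigma>: "0 \<le> \<sigma> v" if "v \<in> L" for v
    using that \<rho>[of v] by (auto simp: \<nu>_def \<sigma>_def)
  have "adj E u v * (\<nu> u * \<nu> v) \<le> adj E u v * \<sigma> v + adj E v u * \<sigma> u"
    if "u \<in> L" "v \<in> L" for u v
  proof (cases "u \<in> I \<and> v \<in> I")
    case True
    then show ?thesis using adj_independent[OF I(1)] by simp
  next
    case False
    have "\<nu> u * \<nu> v \<le> \<sigma> v + \<sigma> u"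
    proof (cases "u \<in> I")
      case True
      with False show ?thesis by (simp add: \<nu>_def \<sigma>_def)
    next
      case u: False
      have "\<nu> u * \<nu> v \<le> \<sigma> u * 1"
        unfolding \<sigma>_def using u \<nu>[OF that(2)] \<rho>[of u] that
        by (simp add: \<nu>_def mult_left_le)
      with \<sigma>[OF that(2)] show ?thesis by simp
    qed
    from mult_left_mono[OF this adj_nonneg[of E u v]] show ?thesis
      by (simp add: adj_commute[of E v u] distrib_left)
  qed
  then have "(\<Sum>u\<in>L. \<Sum>v\<in>L. adj E u v * (\<nu> u * \<nu> v))
      \<le> (\<Sum>u\<in>L. \<Sum>v\<in>L. adj E u v * \<sigma> v + adj E v u * \<sigma> u)"
    by (intro sum_mono)
  also have "\<dots> = (\<Sum>u\<in>L. \<Sum>v\<in>L. adj E u v * \<sigma> v) + (\<Sum>u\<in>L. \<Sum>v\<in>L. adj E v u * \<sigma> u)"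
    by (simp add: sum.distrib)
  also have "(\<Sum>u\<in>L. \<Sum>v\<in>L. adj E u v * \<sigma> v) = (\<Sum>u\<in>L. \<Sum>v\<in>L. adj E v u * \<sigma> u)"
    by (rule sum.swap)
  also have "(\<Sum>u\<in>L. \<Sum>v\<in>L. adj E v u * \<sigma> u) = (\<Sum>u\<in>L. deg_in E L u * \<sigma> u)"
    by (simp add: deg_in_def sum_distrib_right)
  also have "(\<Sum>u\<in>L. deg_in E L u * \<sigma> u) \<le> (\<Sum>u\<in>L. s * \<sigma> u)"
    by (intro sum_mono mult_right_mono deg \<sigma>)
  also have "\<dots> = s * (\<Sum>v\<in>L - I. \<rho> v)"
    unfolding sum_distrib_left[symmetric]
    using L I(2) by (simp add: \<sigma>_def sum.If_cases Diff_eq)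
  finally show ?thesis by simp
qed

text \<open>The half is 1 on \<open>A\<close> and \<open>I\<close>, equals \<open>\<rho>\<close> on
  \<open>L - I\<close> and vanishes elsewhere. Edges between \<open>A\<close> and \<open>L\<close>
  give the \<open>deg_in E A\<close> terms, edges inside \<open>L\<close> at most the terms with
  \<open>s\<close>.\<close>

lemma min_half_density_extend_le:
  fixes \<rho> :: "'a \<Rightarrow> real"
  assumes G: "simple_graph V E" and ne: "V \<noteq> {}"
    and A: "independent_set V E A" and I: "independent_set V E I" "I \<subseteq> L"
    and L: "L \<subseteq> V - A"
    and deg: "\<And>v. v \<in> L \<Longrightarrow> deg_in E L v \<le> s"
    and \<rho>: "\<And>v. v \<in> L - I \<Longrightarrow> 0 \<le> \<rho> v \<and> \<rho> v \<le> 1"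
    and mass: "real (card A) + real (card I) + (\<Sum>v\<in>L - I. \<rho> v) = real (card V) / 2"
  shows "min_half_density V E * (real (card V))\<^sup>2
    \<le> (\<Sum>v\<in>I. deg_in E A v) + (\<Sum>v\<in>L - I. \<rho> v * (deg_in E A v + s))"
proof -
  define \<nu> where "\<nu> v = (if v \<in> I then 1 else \<rho> v)" for v
  define \<mu> where "\<mu> v = (if v \<in> A then 1 else if v \<in> L then \<nu> v else 0)" for v
  have fV: "finite V" using G by (simp add: simple_graph_def)
  have AV: "A \<subseteq> V" using A by (simp add: independent_set_def)
  have fA: "finite A" and fL: "finite L" and fI: "finite I"
    using fV AV L I(2) by (auto intro: finite_subset)
  have AL: "A \<inter> L = {}" using L by auto
  have sum_V: "(\<Sum>v\<in>V. f v) = (\<Sum>v\<in>A. f v) + (\<Sum>v\<in>L. f v)"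
    if "\<And>v. v \<notin> A \<Longrightarrow> v \<notin> L \<Longrightarrow> f v = 0" for f :: "'a \<Rightarrow> real"
  proof -
    have "(\<Sum>v\<in>V. f v) = (\<Sum>v\<in>A \<union> L. f v)"
      using fV AV L that by (intro sum.mono_neutral_right) auto
    then show ?thesis using fA fL AL by (simp add: sum.union_disjoint)
  qed
  have sum_L: "(\<Sum>v\<in>L. \<nu> v * f v) = (\<Sum>v\<in>I. f v) + (\<Sum>v\<in>L - I. \<rho> v * f v)"
    for f :: "'a \<Rightarrow> real"
    unfolding sum.subset_diff[OF I(2) fL] by (simp add: \<nu>_def)
  have \<mu>A: "\<mu> v = 1" if "v \<in> A" for v using that by (simp add: \<mu>_def)
  have \<mu>L: "\<mu> v = \<nu> v" if "v \<in> L" for v using that AL by (auto simp: \<mu>_def)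
  have "is_half V \<mu>"
  proof -
    have "\<mu> v \<in> {0..1}" for v
      using \<rho>[of v] by (auto simp: \<mu>_def \<nu>_def)
    moreover have "(\<Sum>v\<in>V. \<mu> v) = real (card A) + (\<Sum>v\<in>L. \<nu> v)"
      by (subst sum_V) (simp_all add: \<mu>A \<mu>L, simp add: \<mu>_def)
    ultimately show ?thesis
      using mass sum_L[of "\<lambda>_. 1"] by (simp add: is_half_def)
  qed
  from min_half_density_le[OF G this]
  have "min_half_density V E * (real (card V))\<^sup>2 \<le> (\<Sum>e\<in>E. \<Prod>v\<in>e. \<mu> v)"
    using fV ne by (simp add: half_density_def pos_le_divide_eq)
  moreover have "2 * (\<Sum>e\<in>E. \<Prod>v\<in>e. \<mu> v)
    \<le> 2 * ((\<Sum>v\<in>I. deg_in E A v) + (\<Sum>v\<in>L - I. \<rho> v * (deg_in E A v + s)))"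
  proof -
    have row: "(\<Sum>v\<in>V. adj E u v * (\<mu> u * \<mu> v))
        = \<mu> u * deg_in E A u + \<mu> u * (\<Sum>v\<in>L. adj E u v * \<nu> v)" for u
    proof (subst sum_V)
      show "adj E u v * (\<mu> u * \<mu> v) = 0" if "v \<notin> A" "v \<notin> L" for v
        using that by (simp add: \<mu>_def)
    qed (simp add: \<mu>A \<mu>L deg_in_def sum_distrib_left adj_commute[of E u] mult_ac)
    have degA: "deg_in E A u = 0" if "u \<in> A" for u
      using adj_independent[OF A] that by (simp add: deg_in_def)
    have "2 * (\<Sum>e\<in>E. \<Prod>v\<in>e. \<mu> v) = (\<Sum>u\<in>V. \<Sum>v\<in>V. adj E u v * (\<mu> u * \<mu> v))"
      by (rule sum_edges_eq_sum_pairs[OF G])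
    also have "\<dots> = (\<Sum>u\<in>A. \<Sum>v\<in>L. adj E u v * \<nu> v)
        + ((\<Sum>u\<in>L. \<nu> u * deg_in E A u) + (\<Sum>u\<in>L. \<nu> u * (\<Sum>v\<in>L. adj E u v * \<nu> v)))"
      unfolding row by (subst sum_V) (simp_all add: \<mu>A \<mu>L degA sum.distrib, simp add: \<mu>_def)
    \<comment> \<open>The two orientations of the edges between \<open>A\<close> and
      \<open>L\<close> contribute equally.\<close>
    also have "(\<Sum>u\<in>A. \<Sum>v\<in>L. adj E u v * \<nu> v) = (\<Sum>u\<in>L. \<nu> u * deg_in E A u)"
      by (subst sum.swap) (simp add: deg_in_def sum_distrib_left mult_ac)
    also have "(\<Sum>u\<in>L. \<nu> u * (\<Sum>v\<in>L. adj E u v * \<nu> v))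
        = (\<Sum>u\<in>L. \<Sum>v\<in>L. adj E u v * (\<nu> u * \<nu> v))"
      by (simp add: sum_distrib_left mult_ac)
    also have "\<dots> \<le> 2 * s * (\<Sum>v\<in>L - I. \<rho> v)"
      unfolding \<nu>_def by (rule sum_pairs_extend_le[OF fL I deg \<rho>])
    finally show ?thesis
      unfolding sum_L by (simp add: distrib_left sum.distrib sum_distrib_left mult_ac)
  qed
  ultimately show ?thesis
    by (meson mult_le_cancel_left_pos order_trans zero_less_numeral)
qed

text \<open>Put weight 1 on \<open>A\<close> and spread the missing mass evenly over
  \<open>I\<close>. Only edges between \<open>A\<close> and \<open>I\<close> cost anything, at most
  \<open>d\<close> per unit of mass.\<close>

lemma min_half_density_two_independent_le:
  assumes G: "simple_graph V E" and ne: "V \<noteq> {}"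
    and A: "independent_set V E A" and I: "independent_set V E I" and disj: "A \<inter> I = {}"
    and size: "real (card A) \<le> real (card V) / 2" "real (card V) / 2 - real (card A) \<le> real (card I)"
    and deg: "\<And>v. v \<in> I \<Longrightarrow> deg_in E A v \<le> d"
  shows "min_half_density V E * (real (card V))\<^sup>2 \<le> (real (card V) / 2 - real (card A)) * d"
proof -
  define s where "s = real (card V) / 2 - real (card A)"
  have fI: "finite I"
    using G I by (auto simp: simple_graph_def independent_set_def intro: finite_subset)
  \<comment> \<open>If \<open>I\<close> is empty, then the size hypotheses force
    \<open>s = 0\<close>, so division by zero does no harm.\<close>
  have mass: "real (card I) * (s / real (card I)) = s"
    using size s_def by auto
  \<comment> \<open>The extension bound is used with the empty set as its fully weighted part,
    \<open>I\<close> as \<open>L\<close>, and inner degree bound 0.\<close>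
  have "min_half_density V E * (real (card V))\<^sup>2
    \<le> (\<Sum>v\<in>{}. deg_in E A v) + (\<Sum>v\<in>I - {}. s / real (card I) * (deg_in E A v + 0))"
  proof (rule min_half_density_extend_le[OF G ne A])
    show "deg_in E I v \<le> 0" if "v \<in> I" for v
      using adj_independent[OF I] that by (simp add: deg_in_def)
    show "0 \<le> s / real (card I) \<and> s / real (card I) \<le> 1" for v
      using size by (auto simp: s_def divide_le_eq_1)
  qed (use I disj mass in \<open>auto simp: independent_set_def s_def\<close>)
  also have "\<dots> = (\<Sum>v\<in>I. s / real (card I) * deg_in E A v)"
    by simp
  also have "\<dots> \<le> (\<Sum>v\<in>I. s / real (card I) * d)"
    using size by (intro sum_mono mult_left_mono deg) (auto simp: s_def)
  also have "\<dots> = s * d"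
    using mass by (metis sum_constant mult.assoc)
  finally show ?thesis by (simp add: s_def)
qed

section \<open>Averaging over a maximum independent set\<close>

lemma exists_le_zero_of_sum_le_zero:
  fixes f :: "'a \<Rightarrow> real"
  assumes "finite A" "A \<noteq> {}" "(\<Sum>w\<in>A. f w) \<le> 0"
  shows "\<exists>w\<in>A. f w \<le> 0"
  using sum_pos[OF assms(1,2), of f] assms(3) by force

text \<open>By contradiction: if the bound fails, every half built below costs more than
  \<open>s * (K / 2)\<close>, that is, more than \<open>K / 2\<close> per unit of missing
  mass.\<close>

lemma min_half_density_le_of_max_independent:
  assumes G: "simple_graph V E" and tf: "triangle_free E"
    and A: "independent_set V E A"
    and max: "\<And>B. independent_set V E B \<Longrightarrow> card B \<le> card A"
    and size: "real (card A) < real (card V) / 2" "2 / 5 * real (card V) \<le> real (card A)"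
  shows "min_half_density V E * (real (card V))\<^sup>2
    \<le> (real (card V) / 2 - real (card A)) * (real (card A) / 2)"
proof (rule ccontr)
  assume contr: "\<not> ?thesis"
  define K where "K = real (card A)"
  define s where "s = real (card V) / 2 - K"
  define a where "a = deg_in E A"
  define L where "L = {v \<in> V - A. a v \<le> K / 2}"
  \<comment> \<open>The threshold \<open>K / 4\<close> works twice because
    \<open>s \<le> K / 4\<close>: on \<open>Z\<close> even \<open>a v + s\<close> is at most
    \<open>K / 2\<close>, and on the rest of \<open>L\<close> one has
    \<open>s \<le> a v\<close>.\<close>
  define Z where "Z = {v \<in> L. a v < K / 4}"
  have fV: "finite V" using G by (simp add: simple_graph_def)
  have AV: "A \<subseteq> V" using A by (simp add: independent_set_def)
  have fA: "finite A" and fL: "finite L" and fZ: "finite Z" and ZL: "Z \<subseteq> L"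
    using fV AV by (auto simp: L_def Z_def intro: finite_subset)
  have ne: "V \<noteq> {}" using size by auto
  have s0: "0 < s" using size by (simp add: s_def K_def)
  \<comment> \<open>Here the lower bound 2/5 enters: \<open>4 * s \<le> K\<close> is equivalent to
    it.\<close>
  have sK: "4 * s \<le> K" using size by (simp add: s_def K_def)
  have K0: "0 < K" using sK s0 by simp
  have aL: "a v \<le> K / 2" if "v \<in> L" for v using that by (simp add: L_def)
  \<comment> \<open>Without triangles, adjacent vertices have disjoint neighbourhoods in
    \<open>A\<close>.\<close>
  have adj_deg: "a u + a v \<le> K" if "{u, v} \<in> E" for u v
  proof -
    have "{w \<in> A. {w, u} \<in> E} \<inter> {w \<in> A. {w, v} \<in> E} = {}"
      using no_triangle[OF G tf that] by blast
    then have "card {w \<in> A. {w, u} \<in> E} + card {w \<in> A. {w, v} \<in> E}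
        = card ({w \<in> A. {w, u} \<in> E} \<union> {w \<in> A. {w, v} \<in> E})"
      using fA by (simp add: card_Un_disjoint)
    also have "\<dots> \<le> card A"
      using fA by (intro card_mono) auto
    finally show ?thesis
      using fA by (simp add: a_def deg_in_eq_card K_def)
  qed
  \<comment> \<open>Two adjacent vertices of \<open>H\<close> would violate \<open>adj_deg\<close>,
    so \<open>H\<close> is independent and maximality bounds it by \<open>K\<close>. What remains
    for \<open>L\<close> is at least \<open>n - 2K\<close>, which is \<open>2 * s\<close>.\<close>
  have cardL: "2 * s \<le> real (card L)"
  proof -
    define H where "H = {v \<in> V - A. K / 2 < a v}"
    have "independent_set V E H"
      using adj_deg by (fastforce simp: independent_set_def H_def)
    then have "card H \<le> card A" by (rule max)
    moreover have "card V = card A + (card H + card L)"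
    proof -
      have V: "V = A \<union> (H \<union> L)"
        using AV by (auto simp: H_def L_def)
      have "A \<inter> (H \<union> L) = {}" "H \<inter> L = {}" "finite H"
        using fV by (auto simp: H_def L_def)
      then show ?thesis unfolding V using fA fL by (simp add: card_Un_disjoint)
    qed
    ultimately show ?thesis by (simp add: s_def K_def)
  qed
  \<comment> \<open>Otherwise \<open>I\<close> alone could carry the missing mass \<open>s\<close>
    at cost at most \<open>K / 2\<close> per unit.\<close>
  have small: "real (card I) < s" if "independent_set V E I" "I \<subseteq> L" for I
  proof (rule ccontr)
    assume "\<not> ?thesis"
    with min_half_density_two_independent_le[OF G ne A that(1), of "K / 2"] contr size that(2) aL
    show False by (auto simp: s_def K_def a_def L_def)
  qed
  have nbh: "independent_set V E {u \<in> L. {w, u} \<in> E}" for w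
    unfolding independent_set_def
  proof (intro conjI ballI notI)
    fix u v assume *: "u \<in> {u \<in> L. {w, u} \<in> E}" "v \<in> {u \<in> L. {w, u} \<in> E}" "{u, v} \<in> E"
    then show False using no_triangle[OF G tf *(3)] by blast
  qed (auto simp: L_def)
  have deg: "deg_in E L v \<le> s" for v
    using small[OF nbh[of v]] fL by (auto simp: deg_in_eq_card insert_commute)
  define I where "I w = {u \<in> L. {w, u} \<in> E}" for w
  have IL: "I w \<subseteq> L" and fI: "finite (I w)" for w
    using fL by (auto simp: I_def)
  \<comment> \<open>The extension bound read against the assumption: every admissible completion of
    \<open>A\<close> and \<open>I w\<close> is too expensive.\<close>
  have extend: "s * (K / 2) < (\<Sum>v\<in>I w. a v) + (\<Sum>v\<in>L - I w. \<rho> v * (a v + s))"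
    if "\<And>v. v \<in> L - I w \<Longrightarrow> 0 \<le> \<rho> v \<and> \<rho> v \<le> 1" "(\<Sum>v\<in>L - I w. \<rho> v) = s - card (I w)"
    for w \<rho>
  proof -
    have "min_half_density V E * (real (card V))\<^sup>2
      \<le> (\<Sum>v\<in>I w. deg_in E A v) + (\<Sum>v\<in>L - I w. \<rho> v * (deg_in E A v + s))"
      by (rule min_half_density_extend_le[OF G ne A _ IL _ deg that(1)])
        (use nbh[of w] that(2) in \<open>auto simp: I_def L_def s_def K_def\<close>)
    with contr show ?thesis by (simp add: a_def s_def K_def)
  qed
  have aI: "(\<Sum>v\<in>S. a v) \<le> card S * (K / 2)" if "S \<subseteq> L" for S
    using that aL by (intro sum_bounded_above) auto
  have sumL: "(\<Sum>v\<in>L - I w. f v) = (\<Sum>v\<in>Z - I w. f v) + (\<Sum>v\<in>L - (I w \<union> Z). f v)"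
    for f :: "'a \<Rightarrow> real" and w
  proof -
    have "L - I w = (Z - I w) \<union> (L - (I w \<union> Z))" using ZL by auto
    then show ?thesis
      using fL fZ by (simp only:) (auto intro!: sum.union_disjoint)
  qed
  have aZ: "a v + s \<le> K / 2" if "v \<in> Z" for v
    using that sK by (simp add: Z_def)
  \<comment> \<open>If \<open>Z - I w\<close> had room for the mass left after \<open>I w\<close>,
    spreading it evenly there would cost at most \<open>K / 2\<close> per unit. By
    \<open>small\<close> that mass is positive, so the denominator of \<open>c\<close> is nonzero in
    this case.\<close>
  have lack: "card (Z - I w) < s - card (I w)" for w
  proof (rule ccontr)
    define c where "c = (s - card (I w)) / card (Z - I w)"
    define \<rho> where "\<rho> v = (if v \<in> Z then c else 0)" for v
    have I_s: "card (I w) < s" using small[OF nbh[of w]] by (auto simp: I_def)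
    assume "\<not> ?thesis"
    then have c: "0 \<le> c" "c \<le> 1" and cs: "card (Z - I w) * c = s - card (I w)"
      using I_s by (auto simp: c_def divide_le_eq_1)
    have sum\<rho>: "(\<Sum>v\<in>L - I w. \<rho> v * f v) = (\<Sum>v\<in>Z - I w. c * f v)" for f :: "'a \<Rightarrow> real"
      unfolding sumL by (simp add: \<rho>_def)
    have "s * (K / 2) < (\<Sum>v\<in>I w. a v) + (\<Sum>v\<in>L - I w. \<rho> v * (a v + s))"
      using c cs sum\<rho>[of "\<lambda>_. 1"] by (intro extend) (auto simp: \<rho>_def)
    also have "\<dots> \<le> card (I w) * (K / 2) + (\<Sum>v\<in>Z - I w. c * (K / 2))"
      unfolding sum\<rho> using c aZ by (intro add_mono aI[OF IL] sum_mono mult_left_mono) auto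
    also have "\<dots> = card (I w) * (K / 2) + (card (Z - I w) * c) * (K / 2)"
      by simp
    also have "\<dots> = s * (K / 2)"
      unfolding cs by (simp add: algebra_simps)
    finally show False by simp
  qed
  define Y where "Y = L - Z"
  \<comment> \<open>Upper bound for the cost of the half built from \<open>w\<close>, minus \<open>s * (K / 2)\<close>.\<close>
  define excess where
    "excess w = (\<Sum>v\<in>I w \<inter> Y. a v - K / 2 - s) + s * (s - card Z)" for w
  \<comment> \<open>Fill \<open>I w\<close> and \<open>Z\<close>, then spread the rest evenly over
    \<open>R\<close>, where a unit costs at most \<open>K / 2 + s\<close>. Since \<open>I w\<close>
    and \<open>Z - I w\<close> together have fewer than \<open>s\<close> elements and
    \<open>L\<close> has at least \<open>2 * s\<close>, \<open>R\<close> has more than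
    \<open>s\<close> elements, whence \<open>c \<le> 1\<close>.\<close>
  have pos: "0 < excess w" for w
  proof -
    define R where "R = L - (I w \<union> Z)"
    define c where "c = (s - card (I w) - card (Z - I w)) / card R"
    define \<rho> where "\<rho> v = (if v \<in> Z then 1 else c)" for v
    have "card L = card (I w) + card (Z - I w) + card R"
    proof -
      have L: "L = I w \<union> ((Z - I w) \<union> R)" using IL ZL by (auto simp: R_def)
      have "I w \<inter> ((Z - I w) \<union> R) = {}" "(Z - I w) \<inter> R = {}" "finite R"
        using fL by (auto simp: R_def)
      then show ?thesis using fI fZ by (subst L) (simp add: card_Un_disjoint)
    qed
    then have c: "0 \<le> c" "c \<le> 1" and cs: "card R * c = s - card (I w) - card (Z - I w)"
      using lack[of w] cardL s0 by (auto simp: c_def divide_le_eq_1)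
    have sum\<rho>: "(\<Sum>v\<in>L - I w. \<rho> v * f v) = (\<Sum>v\<in>Z - I w. f v) + (\<Sum>v\<in>R. c * f v)"
      for f :: "'a \<Rightarrow> real"
      unfolding sumL R_def[symmetric] by (simp add: \<rho>_def R_def)
    have "s * (K / 2) < (\<Sum>v\<in>I w. a v) + (\<Sum>v\<in>L - I w. \<rho> v * (a v + s))"
      using c cs sum\<rho>[of "\<lambda>_. 1"] by (intro extend) (auto simp: \<rho>_def)
    also have "\<dots> \<le> (\<Sum>v\<in>I w. a v) + ((\<Sum>v\<in>Z - I w. K / 2) + (\<Sum>v\<in>R. c * (K / 2 + s)))"
      unfolding sum\<rho> using c aZ aL
      by (intro add_mono order_refl sum_mono mult_left_mono) (auto simp: R_def)
    also have "\<dots> = (\<Sum>v\<in>I w. a v) + card (Z - I w) * (K / 2) + (card R * c) * (K / 2 + s)"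
      by simp
    \<comment> \<open>Charging \<open>K / 2\<close> on \<open>I w \<inter> Z\<close> makes its size
      cancel, so that the bound depends on \<open>w\<close> only through
      \<open>I w \<inter> Y\<close>.\<close>
    also have "(\<Sum>v\<in>I w. a v) \<le> (\<Sum>v\<in>I w \<inter> Y. a v) + card (I w \<inter> Z) * (K / 2)"
    proof -
      have "I w - Z = I w \<inter> Y" using IL by (auto simp: Y_def)
      then have "(\<Sum>v\<in>I w. a v) = (\<Sum>v\<in>I w \<inter> Z. a v) + (\<Sum>v\<in>I w \<inter> Y. a v)"
        using sum.Int_Diff[OF fI, where g = a and B = Z] by simp
      moreover have "(\<Sum>v\<in>I w \<inter> Z. a v) \<le> card (I w \<inter> Z) * (K / 2)"
        using ZL by (intro aI) auto
      ultimately show ?thesis by simp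
    qed
    finally have lt: "s * (K / 2) < (\<Sum>v\<in>I w \<inter> Y. a v) + card (I w \<inter> Z) * (K / 2)
        + card (Z - I w) * (K / 2) + (card R * c) * (K / 2 + s)"
      by simp
    have cZ: "real (card Z) = card (I w \<inter> Z) + card (Z - I w)"
      using card_Int_Diff[OF fZ, of "I w"] by (simp add: Int_commute)
    have cI: "real (card (I w)) = card (I w \<inter> Y) + card (I w \<inter> Z)"
    proof -
      have "I w - Z = I w \<inter> Y" using IL by (auto simp: Y_def)
      then show ?thesis using card_Int_Diff[OF fI, of w Z] by simp
    qed
    show ?thesis
      using lt unfolding cs excess_def cI cZ
      by (simp add: sum_subtractf algebra_simps)
  qed
  have "(\<Sum>w\<in>A. excess w) \<le> 0"
  proof -
    have fY: "finite Y" using fL by (simp add: Y_def)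
    have "I w \<inter> Y = {v. v \<in> Y \<and> {w, v} \<in> E}" for w
      by (auto simp: I_def Y_def)
    \<comment> \<open>Each \<open>v\<close> in \<open>Y\<close> lies in exactly \<open>a v\<close>
      of the sets \<open>I w\<close>.\<close>
    then have "(\<Sum>w\<in>A. \<Sum>v\<in>I w \<inter> Y. a v - K / 2 - s) = (\<Sum>v\<in>Y. a v * (a v - K / 2 - s))"
      unfolding a_def by (simp only: sum_deg_in[OF fY])
    then have "(\<Sum>w\<in>A. excess w) = (\<Sum>v\<in>Y. a v * (a v - K / 2 - s)) + K * (s * (s - card Z))"
      by (simp add: excess_def sum.distrib K_def)
    also have "s - card Z \<le> card Y / 2"
    proof -
      have "card L = card Y + card Z"
        using fZ ZL fL by (simp add: Y_def card_Diff_subset card_mono)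
      then show ?thesis using cardL by simp
    qed
    \<comment> \<open>Shared equally among the vertices of \<open>Y\<close>, the last term adds
      \<open>K * s / 2\<close> to each summand, which completes it to a quadratic in
      \<open>a v\<close> with roots \<open>K / 2\<close> and \<open>s\<close>.\<close>
    also have "(\<Sum>v\<in>Y. a v * (a v - K / 2 - s)) + K * (s * (card Y / 2))
        = (\<Sum>v\<in>Y. (K / 2 - a v) * (s - a v))"
    proof -
      have "(\<Sum>v\<in>Y. a v * (a v - K / 2 - s)) + K * (s * (card Y / 2))
          = (\<Sum>v\<in>Y. a v * (a v - K / 2 - s) + K * s / 2)"
        by (simp add: sum.distrib)
      also have "\<dots> = (\<Sum>v\<in>Y. (K / 2 - a v) * (s - a v))"
        by (intro sum.cong) (simp_all add: field_simps)
      finally show ?thesis .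
    qed
    \<comment> \<open>On \<open>Y\<close>, \<open>a v\<close> lies between the two roots:
      \<open>s \<le> K / 4 \<le> a v \<le> K / 2\<close>.\<close>
    also have "\<dots> \<le> 0"
    proof (intro sum_nonpos mult_nonneg_nonpos)
      fix v assume "v \<in> Y"
      then show "0 \<le> K / 2 - a v" "s - a v \<le> 0"
        using aL[of v] sK by (auto simp: Y_def Z_def)
    qed
    finally show ?thesis using K0 s0 by (simp add: mult_left_mono)
  qed
  moreover have "A \<noteq> {}" using K0 by (auto simp: K_def)
  ultimately show False
    using exists_le_zero_of_sum_le_zero[OF fA] pos by (meson not_le)
qed

section \<open>The bound 1/50\<close>

theorem corollary3p7:
  fixes V :: "'a set" and E :: "'a set set"
  assumes "simple_graph V E" and "V \<noteq> {}"
    and "triangle_free E"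
    and "rel_indep_number V E \<ge> 2 / 5"
  shows "min_half_density V E \<le> 1 / 50"
proof -
  define n where "n = real (card V)"
  define T where "T = {real (card A) / real (card V) |A. independent_set V E A}"
  have fV: "finite V" using assms(1) by (simp add: simple_graph_def)
  have n0: "0 < n" using fV assms(2) by (simp add: n_def card_gt_0_iff)
  have "finite T"
    by (rule finite_subset[of _ "(\<lambda>A. real (card A) / real (card V)) ` Pow V"])
      (use fV in \<open>auto simp: T_def independent_set_def\<close>)
  moreover have "T \<noteq> {}"
    unfolding T_def by (auto simp: independent_set_def intro: exI[of _ "{}"])
  ultimately have T: "Max T \<in> T" "\<And>t. t \<in> T \<Longrightarrow> t \<le> Max T" by auto
  then obtain A where A: "independent_set V E A" "Max T = real (card A) / n"
    by (auto simp: T_def n_def)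
  define K where "K = real (card A)"
  have Kn: "2 / 5 * n \<le> K"
    using assms(4) A(2) n0 by (simp add: rel_indep_number_def T_def[symmetric] K_def pos_le_divide_eq)
  have max: "card B \<le> card A" if "independent_set V E B" for B
  proof -
    have "real (card B) / n \<in> T" using that by (auto simp: T_def n_def)
    with T(2) A(2) n0 show ?thesis by (fastforce simp: divide_le_cancel)
  qed
  have "min_half_density V E * n\<^sup>2 \<le> n\<^sup>2 / 50"
  proof (cases "K < n / 2")
    case True
    have "min_half_density V E * n\<^sup>2 \<le> (n / 2 - K) * (K / 2)"
      unfolding n_def K_def
      by (rule min_half_density_le_of_max_independent[OF assms(1,3) A(1) max])
        (use True Kn in \<open>auto simp: n_def K_def\<close>)
    \<comment> \<open>This product is 100 times the difference of \<open>n\<^sup>2 / 50\<close> and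
      \<open>(n / 2 - K) * (K / 2)\<close>; it vanishes at \<open>K = 2 / 5 * n\<close>.\<close>
    moreover have "0 \<le> (5 * K - 2 * n) * (10 * K - n)"
      using Kn n0 by (intro mult_nonneg_nonneg) auto
    ultimately show ?thesis by (simp add: algebra_simps power2_eq_square)
  next
    case False
    \<comment> \<open>Now \<open>A\<close> is large enough to carry the whole half: it takes the
      role of the second independent set, with the empty set as the first, and the cost is
      0.\<close>
    have "min_half_density V E * n\<^sup>2 \<le> (n / 2 - real (card ({} :: 'a set))) * 0"
      unfolding n_def
      by (rule min_half_density_two_independent_le[OF assms(1,2) _ A(1)])
        (use False in \<open>auto simp: independent_set_def deg_in_def n_def K_def\<close>)
    also have "\<dots> \<le> n\<^sup>2 / 50" by simp
    finally show ?thesis .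
  qed
  then have "min_half_density V E * n\<^sup>2 \<le> 1 / 50 * n\<^sup>2" by simp
  then show ?thesis by (rule mult_right_le_imp_le) (use n0 in simp)
qed

end
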